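(* Let $K\subseteq\mathbb R^d$ be an origin-symmetric convex body and let $T=\{x\in\mathbb R^d:\ |\langle x,u\rangle|\le 1\}$ be a symmetric slab, where $u\in\mathbb R^d$. Then \[ \gamma_d(\mathrm{conv}\{K\cup T\})\,\gamma_d(K\cap T)\;\ge\;\gamma_d(K)\,\gamma_d(T). \]
   Context: $\gamma_d$ denotes the standard Gaussian probability measure on $\mathbb R^d$, with density proportional to $e^{-\|x\|^2/2}$. $\mathrm{conv}\{S\}$ is the convex hull of $S$. A set $K$ is origin-symmetric if $K=-K$. *)

theory Defs
  imports "HOL-Analysis.Analysis"
begin

text \<open>Standard Gaussian probability measure on a Euclidean space of dimension DIM('a):
  density (2 pi)^(-d/2) exp(-|x|^2/2) with respect to Lebesgue measure.
  We use the Lebesgue (completed) sigma-algebra so that all convex sets are measurable.\<close>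

definition gauss_density :: "'a::euclidean_space \<Rightarrow> real" where
  "gauss_density x = (2 * pi) powr (- real DIM('a) / 2) * exp (- (norm x)\<^sup>2 / 2)"

definition gaussian_measure :: "'a::euclidean_space measure" where
  "gaussian_measure = density lebesgue (\<lambda>x. ennreal (gauss_density x))"

abbreviation gamma :: "'a::euclidean_space set \<Rightarrow> real" where
  "gamma A \<equiv> measure gaussian_measure A"

definition convex_body :: "'a::euclidean_space set \<Rightarrow> bool" where
  "convex_body K \<longleftrightarrow> compact K \<and> convex K \<and> interior K \<noteq> {}"

end

theory Submission
  imports Defs "HOL-Probability.Distributions"
begin

text \<open>Let \<open>e\<close> be the unit vector along \<open>u\<close> and let \<open>b\<close> be the maximum of \<open>x \<bullet> e\<close> over \<open>K\<close>. Unless \<open>K\<close> lies in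
  the slab \<open>T = {\<bar>x \<bullet> e\<bar> \<le> a}\<close>, the convex hull of \<open>K \<union> T\<close> is the slab of half-width \<open>b\<close> up to a null set,
  and \<open>K\<close> is contained in that slab. So the claim says that the average of the Gaussian measure \<open>G t\<close>
  of the slice of \<open>K\<close> at height \<open>t\<close>, taken against the one-dimensional Gaussian, is larger over
  \<open>[-a, a]\<close> than over \<open>[-b, b]\<close>. This holds because \<open>G t\<close> is decreasing in \<open>\<bar>t\<bar>\<close>: for \<open>\<bar>s\<bar> \<le> \<bar>t\<bar>\<close> the slice
  at \<open>s\<close> contains a convex combination of the slices at \<open>t\<close> and \<open>-t\<close>, which have equal measure by symmetry,
  and the Prekopa--Leindler inequality applies.\<close>

section \<open>Brunn--Minkowski on the line and the Prekopa--Leindler inequality\<close>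

lemma emeasure_lborel_vimage_affine:
  fixes A :: "real set"
  assumes "A \<in> sets borel" "p > 0"
  shows "emeasure lborel {x. (x - t) / p \<in> A} = ennreal p * emeasure lborel A"
proof -
  have m: "{x. (x - t) / p \<in> A} \<in> sets borel"
    using measurable_sets_borel[of "\<lambda>x. (x - t) / p" borel A] assms(1)
    by (auto simp: vimage_def)
  have "emeasure lborel {x. (x - t) / p \<in> A} = (\<integral>\<^sup>+x. indicator {x. (x - t) / p \<in> A} x \<partial>lborel)"
    using m by simp
  also have "\<dots> = ennreal \<bar>p\<bar> * (\<integral>\<^sup>+x. indicator {x. (x - t) / p \<in> A} (t + p * x) \<partial>lborel)"
    using m assms(2) by (intro nn_integral_real_affine) auto
  also have "(\<lambda>x. indicator {x. (x - t) / p \<in> A} (t + p * x) :: ennreal) = indicator A"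
    using assms(2) by (auto simp: indicator_def)
  finally show ?thesis using assms by simp
qed

text \<open>Shift \<open>A\<close> by a point near the bottom of \<open>B\<close>, and
  \<open>B\<close> by a point near the top of \<open>A\<close>. Both copies lie in the sumset and
  overlap in a short interval only, so their measures nearly add up. A Borel superset
  \<open>C\<close> replaces the sumset, which need not be Borel.\<close>

lemma brunn_minkowski_real_bounded:
  fixes A B C :: "real set"
  assumes A: "A \<in> sets borel" "A \<noteq> {}" "bounded A"
    and B: "B \<in> sets borel" "B \<noteq> {}" "bounded B"
    and C: "C \<in> sets borel" "\<And>x y. x \<in> A \<Longrightarrow> y \<in> B \<Longrightarrow> x + y \<in> C"
  shows "emeasure lborel A + emeasure lborel B \<le> emeasure lborel C"
proof (rule ennreal_le_epsilon)
  fix e :: real assume e: "e > 0"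
  have bd: "bdd_above A" "bdd_below B"
    using A(3) B(3) bounded_imp_bdd_above bounded_imp_bdd_below by auto
  \<comment> \<open>The copies \<open>A'\<close> and \<open>B'\<close> meet only between
    \<open>\<alpha> + Inf B\<close> and \<open>Sup A + \<beta>\<close>; the two errors of
    \<open>e/2\<close> keep this length below \<open>e\<close>.\<close>
  obtain \<alpha> where \<alpha>: "\<alpha> \<in> A" "Sup A - e/2 < \<alpha>"
    using less_cSupD[OF A(2), of "Sup A - e/2"] e by auto
  obtain \<beta> where \<beta>: "\<beta> \<in> B" "\<beta> < Inf B + e/2"
    using cInf_lessD[OF B(2), of "Inf B + e/2"] e by auto
  define A' where "A' = {x. (x - \<beta>) / 1 \<in> A}"
  define B' where "B' = {x. (x - \<alpha>) / 1 \<in> B}"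
  have m: "A' \<in> sets borel" "B' \<in> sets borel"
    using measurable_sets_borel[of "\<lambda>x. (x - \<beta>) / 1" borel A]
      measurable_sets_borel[of "\<lambda>x. (x - \<alpha>) / 1" borel B] A(1) B(1)
    by (auto simp: vimage_def A'_def B'_def)
  have ex: "emeasure lborel A' = emeasure lborel A" "emeasure lborel B' = emeasure lborel B"
    unfolding A'_def B'_def using A(1) B(1) by (subst emeasure_lborel_vimage_affine; simp)+
  have "A' \<union> B' \<subseteq> C"
    unfolding A'_def B'_def using C(2)[OF _ \<beta>(1)] C(2)[OF \<alpha>(1)] by force
  moreover have "A' \<inter> B' \<subseteq> {\<alpha> + Inf B .. Sup A + \<beta>}"
    unfolding A'_def B'_def using cSup_upper[OF _ bd(1)] cInf_lower[OF _ bd(2)] by force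
  moreover have "emeasure lborel {\<alpha> + Inf B .. Sup A + \<beta>} \<le> ennreal e"
    using \<alpha> \<beta> by (auto intro!: ennreal_leI simp: emeasure_lborel_Icc_eq)
  ultimately have "emeasure lborel (A' \<union> B') \<le> emeasure lborel C"
      "emeasure lborel (A' \<inter> B') \<le> ennreal e"
    using C(1) by (auto intro: emeasure_mono order_trans[OF emeasure_mono, rotated 2])
  then have "emeasure lborel (A' \<union> B') + emeasure lborel (A' \<inter> B') \<le> emeasure lborel C + ennreal e"
    by (rule add_mono)
  then show "emeasure lborel A + emeasure lborel B \<le> emeasure lborel C + ennreal e"
    using emeasure_Un_Int[of A' lborel B'] m by (simp add: ex)
qed

text \<open>Exhaust by the intervals \<open>J n\<close> and pass to the limit. The bounded case
  needs nonempty sets, so it is invoked only from an index \<open>N\<close> on for which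
  \<open>J N\<close> contains a point of each set.\<close>

lemma brunn_minkowski_real:
  fixes A B C :: "real set"
  assumes A: "A \<in> sets borel" "A \<noteq> {}"
    and B: "B \<in> sets borel" "B \<noteq> {}"
    and C: "C \<in> sets borel" "\<And>x y. x \<in> A \<Longrightarrow> y \<in> B \<Longrightarrow> x + y \<in> C"
  shows "emeasure lborel A + emeasure lborel B \<le> emeasure lborel C"
proof -
  define J where "J n = {- real n .. real n}" for n
  have lim: "(\<lambda>n. emeasure lborel (S \<inter> J n)) \<longlonglongrightarrow> emeasure lborel S" if "S \<in> sets borel" for S
  proof -
    have "(\<Union>n. S \<inter> J n) = S"
    proof safe
      fix x assume "x \<in> S"
      obtain n where "\<bar>x\<bar> \<le> real n" using real_arch_simple by blast
      then show "x \<in> (\<Union>n. S \<inter> J n)" using \<open>x \<in> S\<close> by (auto simp: J_def intro!: exI[of _ n])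
    qed
    moreover have "incseq (\<lambda>n. S \<inter> J n)" by (auto simp: incseq_def J_def)
    ultimately show ?thesis
      using Lim_emeasure_incseq[of "\<lambda>n. S \<inter> J n" lborel] that
      by (simp add: J_def image_subset_iff)
  qed
  obtain x y where xy: "x \<in> A" "y \<in> B" using A B by auto
  obtain N where N: "max \<bar>x\<bar> \<bar>y\<bar> \<le> real N" using real_arch_simple by blast
  have "emeasure lborel (A \<inter> J n) + emeasure lborel (B \<inter> J n) \<le> emeasure lborel C" if "n \<ge> N" for n
  proof (rule brunn_minkowski_real_bounded)
    have "max \<bar>x\<bar> \<bar>y\<bar> \<le> real n" using N that by linarith
    then have "x \<in> A \<inter> J n" "y \<in> B \<inter> J n" using xy by (auto simp: J_def)
    then show "A \<inter> J n \<noteq> {}" "B \<inter> J n \<noteq> {}" by blast+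
    show "bounded (A \<inter> J n)" "bounded (B \<inter> J n)" by (auto simp: J_def bounded_Int)
  qed (use A B C in \<open>auto simp: J_def\<close>)
  then show ?thesis
    by (intro LIMSEQ_le_const2[OF tendsto_add[OF lim[OF A(1)] lim[OF B(1)]]]) auto
qed

text \<open>Tonelli for the region under the graph. The strict level sets will serve the functions
  bounded below by hypothesis, the non-strict ones the function in the conclusion. The factor
  \<open>M\<close> rescales levels, so that functions with different suprema can be compared at the
  same \<open>c\<close>.\<close>

lemma nn_integral_layer_cake:
  fixes f :: "real \<Rightarrow> ennreal"
  assumes [measurable]: "f \<in> borel_measurable borel" and M: "M > 0"
  shows "(\<integral>\<^sup>+x. f x \<partial>lborel)
      = ennreal M * (\<integral>\<^sup>+c. indicator {0<..} c * emeasure lborel {x. ennreal (M * c) < f x} \<partial>lborel)"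
    and "(\<integral>\<^sup>+x. f x \<partial>lborel)
      = ennreal M * (\<integral>\<^sup>+c. indicator {0<..} c * emeasure lborel {x. ennreal (M * c) \<le> f x} \<partial>lborel)"
proof -
  have Ioi: "emeasure lborel {0::real<..} = top"
  proof (rule ccontr)
    assume "emeasure lborel {0::real<..} \<noteq> top"
    then have "emeasure lborel {0::real<..} < top" by (simp add: less_top)
    from ennreal_Ex_less_of_nat[OF this] obtain n :: nat
      where "emeasure lborel {0::real<..} < of_nat n" ..
    moreover have "emeasure lborel {0<..real n} \<le> emeasure lborel {0::real<..}"
      by (rule emeasure_mono) auto
    moreover have "emeasure lborel {0<..real n} = of_nat n"
      by (subst emeasure_lborel_Ioc) (simp_all add: ennreal_of_nat_eq_real_of_nat)
    ultimately show False by (metis leD)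
  qed
  \<comment> \<open>This writes a value \<open>r\<close>, possibly infinite, as the length of the
    set of positive levels below it.\<close>
  have len: "emeasure lborel {c. 0 < c \<and> ennreal c < r} = r" 
    "emeasure lborel {c. 0 < c \<and> ennreal c \<le> r} = r" for r
  proof -
    show "emeasure lborel {c. 0 < c \<and> ennreal c < r} = r"
    proof (cases r)
      case (real q)
      then have "{c. 0 < c \<and> ennreal c < r} = {0<..<q}" by (auto simp: ennreal_less_iff)
      then show ?thesis using real by simp
    next
      case top
      then have "{c. 0 < c \<and> ennreal c < r} = {0<..}" by auto
      then show ?thesis using top Ioi by simp
    qed
    show "emeasure lborel {c. 0 < c \<and> ennreal c \<le> r} = r"
    proof (cases r)
      case (real q)
      then have "{c. 0 < c \<and> ennreal c \<le> r} = {0<..q}" by (auto simp: ennreal_le_iff)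
      then show ?thesis using real by simp
    next
      case top
      then have "{c. 0 < c \<and> ennreal c \<le> r} = {0<..}" by auto
      then show ?thesis using top Ioi by simp
    qed
  qed
  have aff: "(\<integral>\<^sup>+c. F c \<partial>lborel) = ennreal M * (\<integral>\<^sup>+c. F (M * c) \<partial>lborel)"
    if "F \<in> borel_measurable borel" for F
    using nn_integral_real_affine[OF that, of M 0] M by simp
  have "(\<integral>\<^sup>+x. f x \<partial>lborel) = (\<integral>\<^sup>+x. \<integral>\<^sup>+c. indicator {c. 0 < c \<and> ennreal c < f x} c \<partial>lborel \<partial>lborel)"
    by (simp add: len)
  also have "\<dots> = (\<integral>\<^sup>+c. \<integral>\<^sup>+x. indicator {c. 0 < c \<and> ennreal c < f x} c \<partial>lborel \<partial>lborel)"
    by (rule lborel_pair.Fubini') measurable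
  also have "\<dots> = ennreal M * (\<integral>\<^sup>+c. \<integral>\<^sup>+x. indicator {c. 0 < c \<and> ennreal c < f x} (M * c) \<partial>lborel \<partial>lborel)"
    by (rule aff) measurable
  also have "(\<lambda>c. \<integral>\<^sup>+x. indicator {c. 0 < c \<and> ennreal c < f x} (M * c) \<partial>lborel)
     = (\<lambda>c. indicator {0<..} c * emeasure lborel {x. ennreal (M * c) < f x})" (is "?l = ?r")
  proof
    fix c
    have "?l c = (\<integral>\<^sup>+x. indicator {0<..} c * indicator {x. ennreal (M * c) < f x} x \<partial>lborel)"
      using M by (intro nn_integral_cong) (auto simp: indicator_def zero_less_mult_iff)
    then show "?l c = ?r c" by (simp add: nn_integral_cmult)
  qed
  finally show "(\<integral>\<^sup>+x. f x \<partial>lborel)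
      = ennreal M * (\<integral>\<^sup>+c. indicator {0<..} c * emeasure lborel {x. ennreal (M * c) < f x} \<partial>lborel)" .
  have "(\<integral>\<^sup>+x. f x \<partial>lborel) = (\<integral>\<^sup>+x. \<integral>\<^sup>+c. indicator {c. 0 < c \<and> ennreal c \<le> f x} c \<partial>lborel \<partial>lborel)"
    by (simp add: len)
  also have "\<dots> = (\<integral>\<^sup>+c. \<integral>\<^sup>+x. indicator {c. 0 < c \<and> ennreal c \<le> f x} c \<partial>lborel \<partial>lborel)"
    by (rule lborel_pair.Fubini') measurable
  also have "\<dots> = ennreal M * (\<integral>\<^sup>+c. \<integral>\<^sup>+x. indicator {c. 0 < c \<and> ennreal c \<le> f x} (M * c) \<partial>lborel \<partial>lborel)"
    by (rule aff) measurable
  also have "(\<lambda>c. \<integral>\<^sup>+x. indicator {c. 0 < c \<and> ennreal c \<le> f x} (M * c) \<partial>lborel)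
     = (\<lambda>c. indicator {0<..} c * emeasure lborel {x. ennreal (M * c) \<le> f x})" (is "?l = ?r")
  proof
    fix c
    have "?l c = (\<integral>\<^sup>+x. indicator {0<..} c * indicator {x. ennreal (M * c) \<le> f x} x \<partial>lborel)"
      using M by (intro nn_integral_cong) (auto simp: indicator_def zero_less_mult_iff)
    then show "?l c = ?r c" by (simp add: nn_integral_cmult)
  qed
  finally show "(\<integral>\<^sup>+x. f x \<partial>lborel)
      = ennreal M * (\<integral>\<^sup>+c. indicator {0<..} c * emeasure lborel {x. ennreal (M * c) \<le> f x} \<partial>lborel)" .
qed

text \<open>Monotone convergence along truncations; it reduces a strict lower bound on an integral
  to the case of a bounded integrand.\<close>

lemma nn_integral_truncate:
  fixes f :: "'a \<Rightarrow> ennreal"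
  assumes [measurable]: "f \<in> borel_measurable M" and "a < (\<integral>\<^sup>+x. f x \<partial>M)"
  obtains n :: nat where "a < (\<integral>\<^sup>+x. min (f x) (of_nat n) \<partial>M)"
proof -
  have sup: "(SUP n. min r (of_nat n)) = r" for r :: ennreal
  proof (cases r)
    case (real q)
    obtain n where "q \<le> real n" using real_arch_simple by blast
    then have "min r (of_nat n) = r" using real by (simp add: ennreal_of_nat_eq_real_of_nat min_def ennreal_le_iff)
    then show ?thesis by (intro antisym SUP_least) (auto intro: SUP_upper2[of n])
  next
    case top
    show ?thesis unfolding top by (intro ennreal_SUP_eq_top) auto
  qed
  have "(\<integral>\<^sup>+x. f x \<partial>M) = (\<integral>\<^sup>+x. (SUP n. min (f x) (of_nat n)) \<partial>M)"
    by (simp add: sup)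
  also have "\<dots> = (SUP n. \<integral>\<^sup>+x. min (f x) (of_nat n) \<partial>M)"
  proof (rule nn_integral_monotone_convergence_SUP)
    show "incseq (\<lambda>n x. min (f x) (of_nat n))"
      unfolding incseq_def le_fun_def by (intro allI impI min.mono order_refl of_nat_mono)
  qed simp
  finally show ?thesis using assms(2) that by (auto simp: less_SUP_iff)
qed

text \<open>The inequality is phrased through strict lower bounds \<open>a < f x\<close>, \<open>b < g y\<close> because \<open>powr\<close> is not
  available on \<open>ennreal\<close>. In this form the conclusion for integrals over a slice is again the hypothesis
  for the marginals, even where those are infinite.\<close>

lemma prekopa_leindler_real:
  fixes f g h :: "real \<Rightarrow> ennreal"
  assumes l: "0 < l" "l < 1"
    and m [measurable]: "f \<in> borel_measurable borel" "g \<in> borel_measurable borel"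
      "h \<in> borel_measurable borel"
    and le: "\<And>x y a b. 0 < a \<Longrightarrow> 0 < b \<Longrightarrow> ennreal a < f x \<Longrightarrow> ennreal b < g y \<Longrightarrow>
      ennreal (a powr (1 - l) * b powr l) \<le> h ((1 - l) * x + l * y)"
    and ab: "0 < a" "0 < b" "ennreal a < (\<integral>\<^sup>+x. f x \<partial>lborel)" "ennreal b < (\<integral>\<^sup>+x. g x \<partial>lborel)"
  shows "ennreal (a powr (1 - l) * b powr l) \<le> (\<integral>\<^sup>+x. h x \<partial>lborel)"
proof -
  \<comment> \<open>Replacing \<open>f\<close> and \<open>g\<close> by smaller functions preserves
    the pointwise hypothesis, so both may be assumed to have a finite positive supremum.\<close>
  have bounded: "\<exists>k M. k \<in> borel_measurable borel \<and> (\<forall>x. k x \<le> j x) \<and> 0 < M \<and>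
      (SUP x. k x) = ennreal M \<and> ennreal c < (\<integral>\<^sup>+x. k x \<partial>lborel)"
    if [measurable]: "j \<in> borel_measurable borel" and c: "ennreal c < (\<integral>\<^sup>+x. j x \<partial>lborel)"
    for j :: "real \<Rightarrow> ennreal" and c
  proof -
    obtain n where n: "ennreal c < (\<integral>\<^sup>+x. min (j x) (of_nat n) \<partial>lborel)"
      using nn_integral_truncate[of j lborel "ennreal c"] c by auto
    define k where "k x = min (j x) (of_nat n)" for x
    have "(SUP x. k x) \<le> of_nat n" by (auto simp: k_def intro!: SUP_least)
    then have "(SUP x. k x) < top" by (rule le_less_trans) (simp add: ennreal_of_nat_eq_real_of_nat)
    then obtain M where M: "M \<ge> 0" "(SUP x. k x) = ennreal M"
      by (cases "(SUP x. k x)") auto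
    have "M \<noteq> 0"
    proof
      assume "M = 0"
      then have "k x = 0" for x
        using M(2) SUP_upper[of x UNIV k] by simp
      then show False using n by (simp add: k_def)
    qed
    then show ?thesis using M n
      by (intro exI[of _ k] exI[of _ M]) (auto simp: k_def[abs_def])
  qed
  obtain f' M where f': "f' \<in> borel_measurable borel" "\<And>x. f' x \<le> f x" "0 < M"
      "(SUP x. f' x) = ennreal M" "ennreal a < (\<integral>\<^sup>+x. f' x \<partial>lborel)"
    using bounded[OF m(1) ab(3)] by blast
  obtain g' N where g': "g' \<in> borel_measurable borel" "\<And>x. g' x \<le> g x" "0 < N"
      "(SUP x. g' x) = ennreal N" "ennreal b < (\<integral>\<^sup>+x. g' x \<partial>lborel)"
    using bounded[OF m(2) ab(4)] by blast
  note [measurable] = f'(1) g'(1)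
  \<comment> \<open>Normalising both suprema makes the level sets \<open>A c\<close> and \<open>B c\<close> nonempty for exactly the same \<open>c\<close>.\<close>
  define R where "R = M powr (1 - l) * N powr l"
  have R: "R > 0" using f' g' by (simp add: R_def)
  define A B D where "A c = {x. ennreal (M * c) < f' x}"
    and "B c = {x. ennreal (N * c) < g' x}" and "D c = {x. ennreal (R * c) \<le> h x}" for c
  have [measurable]: "A c \<in> sets borel" "B c \<in> sets borel" "D c \<in> sets borel" for c
    unfolding A_def B_def D_def by measurable
  have level: "ennreal (1 - l) * emeasure lborel (A c) + ennreal l * emeasure lborel (B c)
      \<le> emeasure lborel (D c)" if c: "c > 0" for c
  \<comment> \<open>For \<open>c < 1\<close> both level sets are nonempty and Brunn-Minkowski
    applies to their dilates by \<open>1 - l\<close> and \<open>l\<close>. For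
    \<open>c \<ge> 1\<close> both are empty, so the left side vanishes.\<close>
  proof (cases "c < 1")
    case True
    have "ennreal (M * c) < (SUP x. f' x)" "ennreal (N * c) < (SUP x. g' x)"
      using True c f'(3,4) g'(3,4) by (auto simp: ennreal_less_iff)
    then obtain x0 y0 where ne: "x0 \<in> A c" "y0 \<in> B c"
      by (auto simp: less_SUP_iff A_def B_def)
    let ?A = "{x. (x - 0) / (1 - l) \<in> A c}" and ?B = "{x. (x - 0) / l \<in> B c}"
    have "emeasure lborel ?A + emeasure lborel ?B \<le> emeasure lborel (D c)"
    proof (rule brunn_minkowski_real)
      show "?A \<in> sets borel" "?B \<in> sets borel"
        using measurable_sets_borel[of "\<lambda>x. (x - 0) / (1 - l)" borel "A c"]
          measurable_sets_borel[of "\<lambda>x. (x - 0) / l" borel "B c"] by (auto simp: vimage_def)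
      have "(1 - l) * x0 \<in> ?A" "l * y0 \<in> ?B" using ne l by auto
      then show "?A \<noteq> {}" "?B \<noteq> {}" by blast+
      fix x y assume "x \<in> ?A" "y \<in> ?B"
      then have "ennreal (M * c) < f (x / (1 - l))" "ennreal (N * c) < g (y / l)"
        using f'(2) g'(2) by (auto simp: A_def B_def intro: less_le_trans)
      then have "ennreal ((M * c) powr (1 - l) * (N * c) powr l)
          \<le> h ((1 - l) * (x / (1 - l)) + l * (y / l))"
        using c f'(3) g'(3) by (intro le) auto
      \<comment> \<open>The weights sum to 1, so the powers of \<open>c\<close> recombine and the
        level for \<open>h\<close> is again linear in \<open>c\<close>.\<close>
      moreover have "(M * c) powr (1 - l) * (N * c) powr l = R * c"
      proof -
        have "c powr (1 - l) * c powr l = c" using c by (simp flip: powr_add)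
        then show ?thesis using c f'(3) g'(3) by (simp add: R_def powr_mult algebra_simps)
      qed
      ultimately show "x + y \<in> D c" using l by (simp add: D_def)
    qed simp
    then show ?thesis
      using l emeasure_lborel_vimage_affine[of "A c" "1 - l" 0]
        emeasure_lborel_vimage_affine[of "B c" l 0] by simp
  next
    case False
    have "f' x \<le> ennreal (M * c)" "g' x \<le> ennreal (N * c)" for x
    proof -
      have "f' x \<le> ennreal M" "g' x \<le> ennreal N"
        using SUP_upper[of x UNIV f'] SUP_upper[of x UNIV g'] f'(4) g'(4) by auto
      then show "f' x \<le> ennreal (M * c)" "g' x \<le> ennreal (N * c)"
        using False f'(3) g'(3) by (auto elim!: order_trans intro!: ennreal_leI)
    qed
    then have "A c = {}" "B c = {}" by (auto simp: A_def B_def not_less)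
    then show ?thesis by simp
  qed
  define X where "X = (\<integral>\<^sup>+c. indicator {0<..} c * emeasure lborel (A c) \<partial>lborel)"
  define Y where "Y = (\<integral>\<^sup>+c. indicator {0<..} c * emeasure lborel (B c) \<partial>lborel)"
  have AB [measurable]: "(\<lambda>c. emeasure lborel (A c)) \<in> borel_measurable borel"
      "(\<lambda>c. emeasure lborel (B c)) \<in> borel_measurable borel"
    unfolding A_def B_def by measurable
  have XY: "ennreal (1 - l) * X + ennreal l * Y
      \<le> (\<integral>\<^sup>+c. indicator {0<..} c * emeasure lborel (D c) \<partial>lborel)"
  proof -
    have "ennreal (1 - l) * X + ennreal l * Y
      = (\<integral>\<^sup>+c. indicator {0<..} c * (ennreal (1 - l) * emeasure lborel (A c) + ennreal l * emeasure lborel (B c)) \<partial>lborel)"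
      unfolding X_def Y_def
      by (simp add: nn_integral_add nn_integral_cmult distrib_left mult.left_commute)
    also have "\<dots> \<le> (\<integral>\<^sup>+c. indicator {0<..} c * emeasure lborel (D c) \<partial>lborel)"
      using level by (intro nn_integral_mono) (auto simp: indicator_def)
    finally show ?thesis .
  qed
  have "ennreal a < ennreal M * X" "ennreal b < ennreal N * Y"
    using f'(5) g'(5) nn_integral_layer_cake(1)[OF f'(1,3)] nn_integral_layer_cake(1)[OF g'(1,3)]
    by (auto simp: X_def Y_def A_def B_def)
  moreover have scale: "ennreal (c / K) \<le> Z" if "K > 0" "c > 0" "ennreal c < ennreal K * Z" for c K Z
    using that
    by (cases Z) (auto simp: ennreal_less_iff ennreal_le_iff2 divide_le_eq mult.commute simp flip: ennreal_mult)
  ultimately have X: "ennreal (a / M) \<le> X" and Y: "ennreal (b / N) \<le> Y"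
    using scale[OF f'(3) ab(1)] scale[OF g'(3) ab(2)] by auto
  \<comment> \<open>Integrating over levels has given an additive bound; the weighted
    arithmetic-geometric mean inequality for \<open>a / M\<close> and \<open>b / N\<close> turns it
    into the multiplicative one.\<close>
  have "a powr (1 - l) * b powr l = R * ((a / M) powr (1 - l) * (b / N) powr l)"
    using f'(3) g'(3) ab(1,2) by (simp add: R_def powr_divide)
  also have "\<dots> \<le> R * ((1 - l) * (a / M) + l * (b / N))"
    using Youngs_inequality_0[of "1 - l" l "a / M" "b / N"] l f'(3) g'(3) ab(1,2) R
    by (intro mult_left_mono) auto
  finally have "ennreal (a powr (1 - l) * b powr l)
      \<le> ennreal R * (ennreal (1 - l) * ennreal (a / M) + ennreal l * ennreal (b / N))"
    using l f'(3) g'(3) ab(1,2) R by (simp flip: ennreal_mult ennreal_plus)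
  also have "\<dots> \<le> ennreal R * (ennreal (1 - l) * X + ennreal l * Y)"
    by (intro mult_left_mono add_mono X Y) auto
  also have "\<dots> \<le> (\<integral>\<^sup>+x. h x \<partial>lborel)"
    using mult_left_mono[OF XY, of "ennreal R"] nn_integral_layer_cake(2)[OF m(3) R]
    by (simp add: D_def)
  finally show ?thesis .
qed

text \<open>Induction on the coordinates: with one coordinate frozen, the induction hypothesis on
  the sections is exactly the pointwise hypothesis of the one-dimensional inequality for the
  marginals.\<close>

lemma prekopa_leindler_PiM:
  fixes f g h :: "('i \<Rightarrow> real) \<Rightarrow> ennreal"
  assumes "finite I" and l: "0 < l" "l < 1"
    and "f \<in> borel_measurable (\<Pi>\<^sub>M i\<in>I. lborel)" "g \<in> borel_measurable (\<Pi>\<^sub>M i\<in>I. lborel)"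
      "h \<in> borel_measurable (\<Pi>\<^sub>M i\<in>I. lborel)"
    and "\<And>x y a b. x \<in> extensional I \<Longrightarrow> y \<in> extensional I \<Longrightarrow> 0 < a \<Longrightarrow> 0 < b \<Longrightarrow>
      ennreal a < f x \<Longrightarrow> ennreal b < g y \<Longrightarrow>
      ennreal (a powr (1 - l) * b powr l) \<le> h (\<lambda>i\<in>I. (1 - l) * x i + l * y i)"
    and "0 < a" "0 < b" "ennreal a < (\<integral>\<^sup>+x. f x \<partial>(\<Pi>\<^sub>M i\<in>I. lborel))"
      "ennreal b < (\<integral>\<^sup>+x. g x \<partial>(\<Pi>\<^sub>M i\<in>I. lborel))"
  shows "ennreal (a powr (1 - l) * b powr l) \<le> (\<integral>\<^sup>+x. h x \<partial>(\<Pi>\<^sub>M i\<in>I. lborel))"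
proof -
  interpret product_sigma_finite "\<lambda>_::'i. lborel :: real measure" ..
  \<comment> \<open>The weight \<open>l\<close> stays fixed, while functions and lower bounds are
    generalised: the sections come with bounds of their own.\<close>
  show ?thesis using assms(1) assms(4-)
  proof (induction I arbitrary: f g h a b rule: finite_induct)
    case empty
    \<comment> \<open>The empty product is a one-point space with point
      \<open>\<lambda>_. undefined\<close>, so the integrals are values there.\<close>
    have "ennreal (a powr (1 - l) * b powr l) \<le> h (\<lambda>i\<in>{}. (1 - l) * undefined + l * undefined)"
      using empty by (intro empty(4)[of "\<lambda>_. undefined" "\<lambda>_. undefined"])
        (auto simp: PiM_empty nn_integral_count_space_finite)
    then show ?case by (simp add: PiM_empty nn_integral_count_space_finite restrict_def)
  next
    case (insert i I)
    note [measurable] = insert.prems(1-3)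
    have sec: "(\<lambda>x. k (x(i := s))) \<in> borel_measurable (\<Pi>\<^sub>M i\<in>I. lborel)"
      if [measurable]: "k \<in> borel_measurable (\<Pi>\<^sub>M i\<in>insert i I. lborel)" for k :: "('i \<Rightarrow> real) \<Rightarrow> ennreal" and s :: real
      by measurable
    have marg: "(\<lambda>s. \<integral>\<^sup>+x. k (x(i := s)) \<partial>(\<Pi>\<^sub>M i\<in>I. lborel)) \<in> borel_measurable borel"
      if [measurable]: "k \<in> borel_measurable (\<Pi>\<^sub>M i\<in>insert i I. lborel)" for k :: "('i \<Rightarrow> real) \<Rightarrow> ennreal"
    proof -
      interpret I: finite_product_sigma_finite "\<lambda>_::'i. lborel :: real measure" I
        by standard (rule insert.hyps)
      have "(\<lambda>s. \<integral>\<^sup>+x. k (x(i := s)) \<partial>(\<Pi>\<^sub>M i\<in>I. lborel)) \<in> borel_measurable lborel"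
        by (rule I.borel_measurable_nn_integral) measurable
      then show ?thesis by simp
    qed
    have int: "integral\<^sup>N (\<Pi>\<^sub>M i\<in>insert i I. lborel) k
        = (\<integral>\<^sup>+s. \<integral>\<^sup>+x. k (x(i := s)) \<partial>(\<Pi>\<^sub>M i\<in>I. lborel) \<partial>lborel)"
      if "k \<in> borel_measurable (\<Pi>\<^sub>M i\<in>insert i I. lborel)" for k :: "('i \<Rightarrow> real) \<Rightarrow> ennreal"
      using product_nn_integral_insert_rev[OF insert.hyps(1,2) that] .
    show ?case unfolding int[OF insert.prems(3)]
    proof (rule prekopa_leindler_real[OF l marg[OF insert.prems(1)] marg[OF insert.prems(2)] marg[OF insert.prems(3)]])
      show "0 < a" "0 < b" by fact+
      show "ennreal a < (\<integral>\<^sup>+s. \<integral>\<^sup>+x. f (x(i := s)) \<partial>(\<Pi>\<^sub>M i\<in>I. lborel) \<partial>lborel)"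
        "ennreal b < (\<integral>\<^sup>+s. \<integral>\<^sup>+x. g (x(i := s)) \<partial>(\<Pi>\<^sub>M i\<in>I. lborel) \<partial>lborel)"
        using insert.prems int by auto
      fix s t p q :: real
      assume pq: "0 < p" "0 < q" "ennreal p < (\<integral>\<^sup>+x. f (x(i := s)) \<partial>(\<Pi>\<^sub>M i\<in>I. lborel))"
        "ennreal q < (\<integral>\<^sup>+x. g (x(i := t)) \<partial>(\<Pi>\<^sub>M i\<in>I. lborel))"
      show "ennreal (p powr (1 - l) * q powr l)
          \<le> (\<integral>\<^sup>+x. h (x(i := (1 - l) * s + l * t)) \<partial>(\<Pi>\<^sub>M i\<in>I. lborel))"
      proof (rule insert.IH[OF sec[OF insert.prems(1)] sec[OF insert.prems(2)] sec[OF insert.prems(3)] _ pq])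
        fix x y :: "'i \<Rightarrow> real" and c d :: real
        assume H: "x \<in> extensional I" "y \<in> extensional I" "0 < c" "0 < d"
          "ennreal c < f (x(i := s))" "ennreal d < g (y(i := t))"
        have "ennreal (c powr (1 - l) * d powr l)
            \<le> h (\<lambda>j\<in>insert i I. (1 - l) * (x(i := s)) j + l * (y(i := t)) j)"
        proof (rule insert.prems(4)[OF _ _ H(3-6)])
          show "x(i := s) \<in> extensional (insert i I)" "y(i := t) \<in> extensional (insert i I)"
            using H(1,2) by (auto simp: extensional_def)
        qed
        also have "(\<lambda>j\<in>insert i I. (1 - l) * (x(i := s)) j + l * (y(i := t)) j)
            = (\<lambda>j\<in>I. (1 - l) * x j + l * y j)(i := (1 - l) * s + l * t)"
        proof
          show "(\<lambda>j\<in>insert i I. (1 - l) * (x(i := s)) j + l * (y(i := t)) j) k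
              = ((\<lambda>j\<in>I. (1 - l) * x j + l * y j)(i := (1 - l) * s + l * t)) k" for k
            by (cases "k = i") auto
        qed
        finally show "ennreal (c powr (1 - l) * d powr l)
          \<le> h ((\<lambda>j\<in>I. (1 - l) * x j + l * y j)(i := (1 - l) * s + l * t))" .
      qed
    qed
  qed
qed

text \<open>Lebesgue measure is the image of the product measure under the linear map
  \<open>E\<close> from coordinates to vectors, which commutes with convex combinations.\<close>

theorem prekopa_leindler:
  fixes f g h :: "'a::euclidean_space \<Rightarrow> ennreal"
  assumes l: "0 < l" "l < 1"
    and m [measurable]: "f \<in> borel_measurable borel" "g \<in> borel_measurable borel"
      "h \<in> borel_measurable borel"
    and le: "\<And>x y a b. 0 < a \<Longrightarrow> 0 < b \<Longrightarrow> ennreal a < f x \<Longrightarrow> ennreal b < g y \<Longrightarrow>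
      ennreal (a powr (1 - l) * b powr l) \<le> h ((1 - l) *\<^sub>R x + l *\<^sub>R y)"
    and ab: "0 < a" "0 < b" "ennreal a < (\<integral>\<^sup>+x. f x \<partial>lborel)" "ennreal b < (\<integral>\<^sup>+x. g x \<partial>lborel)"
  shows "ennreal (a powr (1 - l) * b powr l) \<le> (\<integral>\<^sup>+x. h x \<partial>lborel)"
proof -
  define E where "E x = (\<Sum>b\<in>Basis. x b *\<^sub>R b)" for x :: "'a \<Rightarrow> real"
  have [measurable]: "E \<in> (\<Pi>\<^sub>M b\<in>Basis. lborel) \<rightarrow>\<^sub>M borel"
    unfolding E_def by measurable
  have int: "(\<integral>\<^sup>+x. k x \<partial>lborel) = (\<integral>\<^sup>+x. k (E x) \<partial>(\<Pi>\<^sub>M b\<in>Basis. lborel))"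
    if [measurable]: "k \<in> borel_measurable borel" for k :: "'a \<Rightarrow> ennreal"
    by (subst lborel_eq, subst nn_integral_distr) (auto simp: E_def)
  show ?thesis unfolding int[OF m(3)]
  proof (rule prekopa_leindler_PiM[OF finite_Basis l])
    fix x y :: "'a \<Rightarrow> real" and c d :: real
    assume H: "0 < c" "0 < d" "ennreal c < f (E x)" "ennreal d < g (E y)"
    have "E (\<lambda>i\<in>Basis. (1 - l) * x i + l * y i) = (1 - l) *\<^sub>R E x + l *\<^sub>R E y"
      by (simp add: E_def scaleR_sum_right sum.distrib scaleR_left_distrib)
    then show "ennreal (c powr (1 - l) * d powr l) \<le> h (E (\<lambda>i\<in>Basis. (1 - l) * x i + l * y i))"
      using le[OF H] by simp
  next
    show "ennreal a < (\<integral>\<^sup>+x. f (E x) \<partial>(\<Pi>\<^sub>M b\<in>Basis. lborel))"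
      "ennreal b < (\<integral>\<^sup>+x. g (E x) \<partial>(\<Pi>\<^sub>M b\<in>Basis. lborel))"
      using ab(3,4) unfolding int[OF m(1)] int[OF m(2)] .
  qed (measurable, fact+)
qed

section \<open>The Gaussian measure and its hyperplane slices\<close>

lemma gauss_density_eq_prod: "gauss_density x = (\<Prod>b\<in>Basis. std_normal_density (x \<bullet> b))"
proof -
  have "norm x ^ 2 = (\<Sum>b\<in>Basis. (x \<bullet> b)\<^sup>2)"
    by (simp add: norm_eq_sqrt_inner euclidean_inner[of x x] power2_eq_square sum_nonneg)
  then have "(\<Prod>b\<in>Basis. exp (- (x \<bullet> b)\<^sup>2 / 2)) = exp (- (norm x)\<^sup>2 / 2)"
    by (simp add: exp_sum sum_negf sum_divide_distrib flip: exp_sum)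
  moreover have "(1 / sqrt (2 * pi)) ^ DIM('a) = (2 * pi) powr (- real DIM('a) / 2)"
  proof -
    have "1 / sqrt (2 * pi) = (2 * pi) powr (- 1 / 2)"
      by (simp add: powr_half_sqrt powr_minus_divide)
    then show ?thesis by (simp add: powr_powr flip: powr_realpow)
  qed
  ultimately show ?thesis
    by (simp add: gauss_density_def std_normal_density_def prod.distrib prod_dividef
        power_divide field_simps)
qed

lemma gauss_density_nonneg [simp]: "0 \<le> gauss_density x"
  by (simp add: gauss_density_def)

lemma gauss_density_measurable [measurable]: "gauss_density \<in> borel_measurable borel"
  unfolding gauss_density_def by measurable

text \<open>Log-concavity comes from convexity of the squared norm. The strict lower bounds
  \<open>a\<close> and \<open>b\<close> match the pointwise hypothesis of
  \<open>prekopa_leindler\<close>.\<close>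

lemma gauss_density_log_concave:
  fixes x y :: "'a::euclidean_space"
  assumes l: "0 < l" "l < 1" and ab: "0 < a" "a < gauss_density x" "0 < b" "b < gauss_density y"
  shows "a powr (1 - l) * b powr l \<le> gauss_density ((1 - l) *\<^sub>R x + l *\<^sub>R y)"
proof -
  define c where "c = (2 * pi) powr (- real DIM('a) / 2)"
  have c: "c > 0" by (simp add: c_def)
  have "(1 - l) * (norm x)\<^sup>2 + l * (norm y)\<^sup>2 - (norm ((1 - l) *\<^sub>R x + l *\<^sub>R y))\<^sup>2
      = l * (1 - l) * (norm (x - y))\<^sup>2"
    unfolding power2_norm_eq_inner
    by (simp add: inner_simps inner_commute[of y x] algebra_simps)
  then have n: "(norm ((1 - l) *\<^sub>R x + l *\<^sub>R y))\<^sup>2 \<le> (1 - l) * (norm x)\<^sup>2 + l * (norm y)\<^sup>2"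
    using l by (smt (verit) mult_nonneg_nonneg zero_le_power2)
  have "a powr (1 - l) * b powr l \<le> gauss_density x powr (1 - l) * gauss_density y powr l"
    using l ab by (intro mult_mono powr_mono2) auto
  also have "\<dots> = (c powr (1 - l) * c powr l)
      * (exp (- (norm x)\<^sup>2 / 2 * (1 - l)) * exp (- (norm y)\<^sup>2 / 2 * l))"
    using c unfolding gauss_density_def c_def[symmetric]
    by (simp add: powr_mult exp_powr_real)
  also have "exp (- (norm x)\<^sup>2 / 2 * (1 - l)) * exp (- (norm y)\<^sup>2 / 2 * l)
      = exp (- ((1 - l) * (norm x)\<^sup>2 + l * (norm y)\<^sup>2) / 2)"
    unfolding exp_add[symmetric] by (simp add: field_simps)
  also have "c powr (1 - l) * c powr l = c" using c by (simp flip: powr_add)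
  also have "c * exp (- ((1 - l) * (norm x)\<^sup>2 + l * (norm y)\<^sup>2) / 2)
      \<le> gauss_density ((1 - l) *\<^sub>R x + l *\<^sub>R y)"
    using n c unfolding gauss_density_def c_def[symmetric] by simp
  finally show ?thesis .
qed

section \<open>Total mass and Borel sets of the Gaussian measure\<close>

lemma space_gaussian_measure [simp]: "space gaussian_measure = UNIV"
  by (simp add: gaussian_measure_def)

lemma sets_gaussian_measure [simp]: "sets gaussian_measure = sets lebesgue"
  by (simp add: gaussian_measure_def)

text \<open>Moves from the completed measure to \<open>lborel\<close>, where Tonelli and the changes
  of variables are carried out.\<close>

lemma emeasure_gaussian_measure:
  fixes A :: "'a::euclidean_space set"
  assumes "A \<in> sets borel"
  shows "emeasure gaussian_measure A = (\<integral>\<^sup>+x. ennreal (gauss_density x) * indicator A x \<partial>lborel)"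
proof -
  have "emeasure gaussian_measure A = (\<integral>\<^sup>+x. ennreal (gauss_density x) * indicator A x \<partial>lebesgue)"
    unfolding gaussian_measure_def using assms
    by (intro emeasure_density) (auto intro!: measurable_completion)
  then show ?thesis using assms by (simp add: nn_integral_completion)
qed

lemma nn_integral_std_normal_density: "(\<integral>\<^sup>+t. ennreal (std_normal_density t) \<partial>lborel) = 1"
  using prob_space.emeasure_space_1[OF prob_space_normal_density[of 1 0]]
  by (simp add: emeasure_density)

lemma prob_space_gaussian_measure: "prob_space (gaussian_measure :: 'a::euclidean_space measure)"
proof
  have "emeasure gaussian_measure (UNIV :: 'a set)
      = (\<integral>\<^sup>+x. (\<Prod>b\<in>Basis. ennreal (std_normal_density (x \<bullet> b))) \<partial>(lborel :: 'a measure))"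
    by (simp add: emeasure_gaussian_measure gauss_density_eq_prod prod_ennreal)
  also have "\<dots> = 1"
    by (subst nn_integral_lborel_prod) (auto simp: nn_integral_std_normal_density)
  finally show "emeasure gaussian_measure (space gaussian_measure :: 'a set) = 1" by simp
qed

lemma nn_integral_lborel_translation:
  fixes f :: "'a::euclidean_space \<Rightarrow> ennreal"
  assumes [measurable]: "f \<in> borel_measurable borel"
  shows "(\<integral>\<^sup>+x. f (x + c) \<partial>lborel) = (\<integral>\<^sup>+x. f x \<partial>lborel)"
proof -
  have "(\<integral>\<^sup>+x. f x \<partial>lborel) = (\<integral>\<^sup>+x. f x \<partial>distr lborel borel ((+) c))"
    by (simp only: lborel_distr_plus)
  then show ?thesis by (simp add: nn_integral_distr add.commute)
qed

lemma nn_integral_lborel_reflect: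
  fixes f :: "'a::euclidean_space \<Rightarrow> ennreal"
  assumes [measurable]: "f \<in> borel_measurable borel"
  shows "(\<integral>\<^sup>+x. f (- x) \<partial>lborel) = (\<integral>\<^sup>+x. f x \<partial>lborel)"
proof -
  have "lborel = distr lborel borel (uminus :: 'a \<Rightarrow> 'a)"
    using lborel_affine[of "-1" "0::'a"] by (simp add: density_1)
  then have "(\<integral>\<^sup>+x. f x \<partial>lborel) = (\<integral>\<^sup>+x. f x \<partial>distr lborel borel uminus)"
    by simp
  then show ?thesis by (simp add: nn_integral_distr)
qed

text \<open>The component along \<open>e\<close> of a Gaussian vector is replaced by \<open>t\<close>; integrating over the whole space
  instead of the hyperplane avoids a rotation of coordinates.\<close>

definition slice_measure :: "'a::euclidean_space \<Rightarrow> 'a set \<Rightarrow> real \<Rightarrow> ennreal" where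
  "slice_measure e K t =
    (\<integral>\<^sup>+x. ennreal (gauss_density x) * indicator K (x - (x \<bullet> e) *\<^sub>R e + t *\<^sub>R e) \<partial>lborel)"

lemma slice_measure_measurable [measurable]:
  assumes [measurable]: "K \<in> sets borel"
  shows "slice_measure e K \<in> borel_measurable borel"
  unfolding slice_measure_def[abs_def]
  by (rule lborel.borel_measurable_nn_integral) measurable

text \<open>Insert \<open>1 = \<integral> q (x \<bullet> e - t) dt\<close> and translate, first \<open>x\<close> by \<open>t e\<close> and then \<open>t\<close> by \<open>- x \<bullet> e\<close>.\<close>

lemma gaussian_slices:
  fixes K :: "'a::euclidean_space set"
  assumes e: "norm e = 1" and [measurable]: "K \<in> sets borel" "J \<in> sets borel"
  shows "emeasure gaussian_measure {x \<in> K. x \<bullet> e \<in> J}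
    = (\<integral>\<^sup>+t. ennreal (std_normal_density t) * indicator J t * slice_measure e K t \<partial>lborel)"
proof -
  define q where "q t = ennreal (std_normal_density t)" for t
  define A where "A = {x \<in> K. x \<bullet> e \<in> J}"
  define F where "F x = ennreal (gauss_density x) * indicator A x" for x
  \<comment> \<open>The orthogonal projection onto the hyperplane orthogonal to
    \<open>e\<close>.\<close>
  define P where "P x = x - (x \<bullet> e) *\<^sub>R e" for x
  have [measurable]: "A \<in> sets borel" unfolding A_def by measurable
  have [measurable]: "F \<in> borel_measurable borel" "q \<in> borel_measurable borel"
    "P \<in> borel_measurable borel"
    unfolding F_def q_def P_def by measurable
  have ee: "e \<bullet> e = 1" using e by (simp add: norm_eq_1)
  have Pe: "P x \<bullet> e = 0" "e \<bullet> P x = 0" for x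
    by (simp_all add: P_def inner_diff_left inner_diff_right ee inner_commute)
  have pyth: "(norm (P x + t *\<^sub>R e))\<^sup>2 = (norm (P x))\<^sup>2 + t\<^sup>2" for x t
    unfolding power2_norm_eq_inner
    by (simp add: inner_add_left inner_add_right ee Pe power2_eq_square)
  \<comment> \<open>By Pythagoras both exponents involve
    \<open>(norm (P x))\<^sup>2 + t\<^sup>2 + (x \<bullet> e)\<^sup>2\<close>: the two heights
    \<open>t\<close> and \<open>x \<bullet> e\<close> may be exchanged.\<close>
  have key: "ennreal (gauss_density (P x + t *\<^sub>R e)) * q (x \<bullet> e) = q t * ennreal (gauss_density x)" for x t
  proof -
    have "P x + (x \<bullet> e) *\<^sub>R e = x" by (simp add: P_def)
    then have x: "(norm x)\<^sup>2 = (norm (P x))\<^sup>2 + (x \<bullet> e)\<^sup>2" using pyth[of x "x \<bullet> e"] by simp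
    have "exp (- (norm (P x + t *\<^sub>R e))\<^sup>2 / 2) * exp (- (x \<bullet> e)\<^sup>2 / 2)
        = exp (- t\<^sup>2 / 2) * exp (- (norm x)\<^sup>2 / 2)"
      unfolding exp_add[symmetric] pyth x by (simp add: field_simps)
    then have "(c * exp (- (norm (P x + t *\<^sub>R e))\<^sup>2 / 2)) * (d * exp (- (x \<bullet> e)\<^sup>2 / 2))
        = (d * exp (- t\<^sup>2 / 2)) * (c * exp (- (norm x)\<^sup>2 / 2))" for c d
      by (metis mult.assoc mult.commute mult.left_commute)
    then have "gauss_density (P x + t *\<^sub>R e) * std_normal_density (x \<bullet> e)
        = std_normal_density t * gauss_density x"
      unfolding gauss_density_def std_normal_density_def .
    then show ?thesis by (simp add: q_def flip: ennreal_mult)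
  qed
  have qt: "(\<integral>\<^sup>+t. q (r - t) \<partial>lborel) = 1" for r
    using nn_integral_lborel_reflect[of "\<lambda>t. q (r + t)"] nn_integral_lborel_translation[of q r]
    by (simp add: q_def nn_integral_std_normal_density add.commute)
  have "emeasure gaussian_measure A = (\<integral>\<^sup>+x. F x \<partial>lborel)"
    by (simp add: emeasure_gaussian_measure F_def)
  also have "\<dots> = (\<integral>\<^sup>+x. \<integral>\<^sup>+t. F x * q (x \<bullet> e - t) \<partial>lborel \<partial>lborel)"
    by (simp add: nn_integral_cmult qt)
  also have "\<dots> = (\<integral>\<^sup>+t. \<integral>\<^sup>+x. F x * q (x \<bullet> e - t) \<partial>lborel \<partial>lborel)"
    by (rule lborel_pair.Fubini') measurable
  also have "\<dots> = (\<integral>\<^sup>+t. \<integral>\<^sup>+x. F (x + t *\<^sub>R e) * q (x \<bullet> e) \<partial>lborel \<partial>lborel)"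
  proof (rule nn_integral_cong)
    fix t
    show "(\<integral>\<^sup>+x. F x * q (x \<bullet> e - t) \<partial>lborel) = (\<integral>\<^sup>+x. F (x + t *\<^sub>R e) * q (x \<bullet> e) \<partial>lborel)"
      using nn_integral_lborel_translation[of "\<lambda>x. F x * q (x \<bullet> e - t)" "t *\<^sub>R e"]
      by (simp add: inner_simps ee)
  qed
  also have "\<dots> = (\<integral>\<^sup>+x. \<integral>\<^sup>+t. F (x + t *\<^sub>R e) * q (x \<bullet> e) \<partial>lborel \<partial>lborel)"
    by (rule lborel_pair.Fubini') measurable
  also have "\<dots> = (\<integral>\<^sup>+x. \<integral>\<^sup>+t. F (P x + t *\<^sub>R e) * q (x \<bullet> e) \<partial>lborel \<partial>lborel)"
  proof (rule nn_integral_cong)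
    fix x
    show "(\<integral>\<^sup>+t. F (x + t *\<^sub>R e) * q (x \<bullet> e) \<partial>lborel) = (\<integral>\<^sup>+t. F (P x + t *\<^sub>R e) * q (x \<bullet> e) \<partial>lborel)"
      using nn_integral_lborel_translation[of "\<lambda>t. F (x + t *\<^sub>R e) * q (x \<bullet> e)" "- (x \<bullet> e)"]
      by (simp add: P_def scaleR_left_distrib algebra_simps)
  qed
  also have "\<dots> = (\<integral>\<^sup>+t. \<integral>\<^sup>+x. F (P x + t *\<^sub>R e) * q (x \<bullet> e) \<partial>lborel \<partial>lborel)"
    by (rule lborel_pair.Fubini'[symmetric]) measurable
  also have "\<dots> = (\<integral>\<^sup>+t. q t * indicator J t * slice_measure e K t \<partial>lborel)"
  proof (rule nn_integral_cong)
    fix t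
    have "F (P x + t *\<^sub>R e) * q (x \<bullet> e)
        = q t * indicator J t * (ennreal (gauss_density x) * indicator K (P x + t *\<^sub>R e))" for x
    proof -
      \<comment> \<open>The point \<open>P x + t *\<^sub>R e\<close> has height exactly
        \<open>t\<close>, so membership in \<open>J\<close> no longer depends on
        \<open>x\<close>.\<close>
      have "indicator A (P x + t *\<^sub>R e) = (indicator J t * indicator K (P x + t *\<^sub>R e) :: ennreal)"
        by (auto simp: A_def indicator_def inner_simps Pe ee)
      moreover have "F (P x + t *\<^sub>R e) * q (x \<bullet> e)
          = ennreal (gauss_density (P x + t *\<^sub>R e)) * q (x \<bullet> e) * indicator A (P x + t *\<^sub>R e)"
        by (simp add: F_def ac_simps)
      ultimately show ?thesis unfolding key by (simp add: ac_simps)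
    qed
    then show "(\<integral>\<^sup>+x. F (P x + t *\<^sub>R e) * q (x \<bullet> e) \<partial>lborel) = q t * indicator J t * slice_measure e K t"
      by (simp add: slice_measure_def nn_integral_cmult flip: P_def)
  qed
  finally show ?thesis by (simp add: A_def q_def)
qed

text \<open>The substitution of \<open>- x\<close> for \<open>x\<close> preserves the density and
  carries the slice at \<open>- t\<close> to the negative of the slice at \<open>t\<close>.\<close>

lemma slice_measure_reflect:
  fixes K :: "'a::euclidean_space set"
  assumes [measurable]: "K \<in> sets borel" and sym: "\<And>x. x \<in> K \<Longrightarrow> - x \<in> K"
  shows "slice_measure e K (- t) = slice_measure e K t"
proof -
  define P where "P x = x - (x \<bullet> e) *\<^sub>R e" for x
  have [measurable]: "P \<in> borel_measurable borel" unfolding P_def by measurable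
  have K: "- x \<in> K \<longleftrightarrow> x \<in> K" for x using sym[of x] sym[of "- x"] by auto
  have "slice_measure e K (- t) = (\<integral>\<^sup>+x. ennreal (gauss_density x) * indicator K (P x + (- t) *\<^sub>R e) \<partial>lborel)"
    by (simp add: slice_measure_def P_def)
  also have "\<dots> = (\<integral>\<^sup>+x. ennreal (gauss_density (- x)) * indicator K (P (- x) + (- t) *\<^sub>R e) \<partial>lborel)"
    by (rule nn_integral_lborel_reflect[symmetric]) measurable
  also have "\<dots> = slice_measure e K t"
    unfolding slice_measure_def
  proof (rule nn_integral_cong)
    fix x
    have "P (- x) + (- t) *\<^sub>R e = - (x - (x \<bullet> e) *\<^sub>R e + t *\<^sub>R e)" by (simp add: P_def)
    then show "ennreal (gauss_density (- x)) * indicator K (P (- x) + (- t) *\<^sub>R e)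
        = ennreal (gauss_density x) * indicator K (x - (x \<bullet> e) *\<^sub>R e + t *\<^sub>R e)"
      using K[of "x - (x \<bullet> e) *\<^sub>R e + t *\<^sub>R e"] by (simp add: gauss_density_def indicator_def)
  qed
  finally show ?thesis .
qed

lemma slice_measure_antimono:
  fixes K :: "'a::euclidean_space set"
  assumes K [measurable]: "K \<in> sets borel" and "convex K"
    and sym: "\<And>x. x \<in> K \<Longrightarrow> - x \<in> K" and st: "\<bar>s\<bar> \<le> \<bar>t\<bar>"
  shows "slice_measure e K t \<le> slice_measure e K s"
\<comment> \<open>Equal absolute heights would give weight 0 or 1, or a division by zero; the
  reflection settles them.\<close>
proof (cases "\<bar>s\<bar> = \<bar>t\<bar>")
  case True
  then have "s = t \<or> s = - t" by linarith
  then show ?thesis using slice_measure_reflect[OF K sym] by auto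
next
  case False
  with st have st: "\<bar>s\<bar> < \<bar>t\<bar>" by simp
  \<comment> \<open>Chosen so that \<open>s\<close> is the combination of \<open>t\<close> and
    \<open>- t\<close> with weights \<open>1 - l\<close> and \<open>l\<close>.\<close>
  define l where "l = (1 - s / t) / 2"
  have "\<bar>s / t\<bar> < 1" using st by simp
  then have l: "0 < l" "l < 1" unfolding l_def by argo+
  have s: "s = (1 - l) * t - l * t" using st by (simp add: l_def field_simps)
  define P where "P x = x - (x \<bullet> e) *\<^sub>R e" for x
  have [measurable]: "P \<in> borel_measurable borel" unfolding P_def by measurable
  have eq: "slice_measure e K t = (\<integral>\<^sup>+x. ennreal (gauss_density x) * indicator K (P x + t *\<^sub>R e) \<partial>lborel)" for t
    by (simp add: slice_measure_def P_def)
  show ?thesis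
  proof (rule dense_le)
    fix w assume w: "w < slice_measure e K t"
    show "w \<le> slice_measure e K s"
    proof (cases w)
      case (real r)
      show ?thesis
      proof (cases "r = 0")
        case False
        then have r: "r > 0" using real by simp
        \<comment> \<open>The slices at \<open>t\<close> and \<open>- t\<close> have equal measure,
          so the same \<open>r\<close> serves for both and their geometric mean is \<open>r\<close>
          itself.\<close>
        have "ennreal (r powr (1 - l) * r powr l) \<le> slice_measure e K s"
          unfolding eq[of s]
        proof (rule prekopa_leindler[OF l _ _ _ _ r r])
          show "ennreal r < (\<integral>\<^sup>+x. ennreal (gauss_density x) * indicator K (P x + t *\<^sub>R e) \<partial>lborel)"
            "ennreal r < (\<integral>\<^sup>+x. ennreal (gauss_density x) * indicator K (P x + (- t) *\<^sub>R e) \<partial>lborel)"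
            using w real slice_measure_reflect[OF K sym, of e t] unfolding eq[symmetric] by auto
          fix x y a b
          assume ab: "0 < a" "0 < b" "ennreal a < ennreal (gauss_density x) * indicator K (P x + t *\<^sub>R e)"
            "ennreal b < ennreal (gauss_density y) * indicator K (P y + (- t) *\<^sub>R e)"
          \<comment> \<open>A positive strict lower bound forces both indicators to be 1.\<close>
          then have K: "P x + t *\<^sub>R e \<in> K" "P y + (- t) *\<^sub>R e \<in> K"
            and "a < gauss_density x" "b < gauss_density y"
            by (cases "P x + t *\<^sub>R e \<in> K"; cases "P y + (- t) *\<^sub>R e \<in> K";
              auto simp: ennreal_less_iff)+
          then have "a powr (1 - l) * b powr l \<le> gauss_density ((1 - l) *\<^sub>R x + l *\<^sub>R y)"
            using gauss_density_log_concave l ab by blast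
          moreover have "P ((1 - l) *\<^sub>R x + l *\<^sub>R y) + s *\<^sub>R e
              = (1 - l) *\<^sub>R (P x + t *\<^sub>R e) + l *\<^sub>R (P y + (- t) *\<^sub>R e)"
            by (simp add: P_def s inner_simps algebra_simps, simp flip: scaleR_add_left)
          then have "P ((1 - l) *\<^sub>R x + l *\<^sub>R y) + s *\<^sub>R e \<in> K"
            using convexD[OF \<open>convex K\<close> K, of "1 - l" l] l by simp
          ultimately show "ennreal (a powr (1 - l) * b powr l)
              \<le> ennreal (gauss_density ((1 - l) *\<^sub>R x + l *\<^sub>R y))
                * indicator K (P ((1 - l) *\<^sub>R x + l *\<^sub>R y) + s *\<^sub>R e)"
            by (simp add: ennreal_leI)
        qed measurable
        then show ?thesis using r real by (simp flip: powr_add)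
      qed (simp add: real)
    qed (use w in simp)
  qed
qed

section \<open>Averages of symmetric decreasing functions\<close>

text \<open>The value \<open>G a\<close> separates the two regions: \<open>G\<close> is at least
  \<open>G a\<close> on the inner interval and at most \<open>G a\<close> on the remainder
  \<open>R\<close>. Cross-multiplying avoids quotients.\<close>

lemma nn_integral_average_antimono:
  fixes w G :: "real \<Rightarrow> ennreal"
  assumes [measurable]: "w \<in> borel_measurable borel" "G \<in> borel_measurable borel"
    and G: "\<And>s t. \<bar>s\<bar> \<le> \<bar>t\<bar> \<Longrightarrow> G t \<le> G s" and ab: "0 \<le> a" "a \<le> b"
  shows "(\<integral>\<^sup>+t. w t * indicator {-b..b} t * G t \<partial>lborel) * (\<integral>\<^sup>+t. w t * indicator {-a..a} t \<partial>lborel)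
    \<le> (\<integral>\<^sup>+t. w t * indicator {-b..b} t \<partial>lborel) * (\<integral>\<^sup>+t. w t * indicator {-a..a} t * G t \<partial>lborel)"
proof -
  define R where "R = {-b..b} - {-a..a}"
  define U V X Y where "U = (\<integral>\<^sup>+t. w t * indicator {-a..a} t \<partial>lborel)"
    and "V = (\<integral>\<^sup>+t. w t * indicator R t \<partial>lborel)"
    and "X = (\<integral>\<^sup>+t. w t * indicator {-a..a} t * G t \<partial>lborel)"
    and "Y = (\<integral>\<^sup>+t. w t * indicator R t * G t \<partial>lborel)"
  have [measurable]: "R \<in> sets borel" by (simp add: R_def)
  have ind: "(indicator {-b..b} t :: ennreal) = indicator {-a..a} t + indicator R t" for t
    using ab by (auto simp: R_def indicator_def)
  have UV: "(\<integral>\<^sup>+t. w t * indicator {-b..b} t \<partial>lborel) = U + V"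
    unfolding U_def V_def by (subst nn_integral_add[symmetric]) (auto simp: ind distrib_left)
  have XY: "(\<integral>\<^sup>+t. w t * indicator {-b..b} t * G t \<partial>lborel) = X + Y"
    unfolding X_def Y_def
    by (subst nn_integral_add[symmetric]) (auto simp: ind distrib_left distrib_right)
  have "U * G a = (\<integral>\<^sup>+t. w t * indicator {-a..a} t * G a \<partial>lborel)"
    unfolding U_def by (rule nn_integral_multc[symmetric]) measurable
  also have "\<dots> \<le> X"
    unfolding X_def using G[of _ a] ab
    by (intro nn_integral_mono) (auto simp: indicator_def intro!: mult_left_mono)
  finally have X: "U * G a \<le> X" .
  have "Y \<le> (\<integral>\<^sup>+t. w t * indicator R t * G a \<partial>lborel)"
    unfolding Y_def using G[of a] ab
    by (intro nn_integral_mono) (auto simp: indicator_def R_def intro!: mult_left_mono)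
  also have "\<dots> = V * G a"
    unfolding V_def by (rule nn_integral_multc) measurable
  finally have Y: "Y \<le> V * G a" .
  have "Y * U \<le> V * G a * U" using Y by (rule mult_right_mono) simp
  also have "\<dots> = V * (U * G a)" by (simp add: ac_simps)
  also have "\<dots> \<le> V * X" using X by (rule mult_left_mono) simp
  finally have "Y * U \<le> V * X" .
  then have "(X + Y) * U \<le> (U + V) * X"
    by (simp add: distrib_left distrib_right mult.commute[of X U])
  then show ?thesis by (simp only: XY UV U_def X_def)
qed

section \<open>The convex hull of body and slab, and the conclusion\<close>

text \<open>A convex set differs from its interior by part of its frontier, which is negligible.
  This covers the hull of \<open>K \<union> T\<close>, which need not be closed.\<close>

lemma convex_sets_lebesgue:
  fixes S :: "'a::euclidean_space set"
  assumes "convex S"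
  shows "S \<in> sets lebesgue"
proof -
  have "S \<inter> frontier S \<in> sets lebesgue"
    using negligible_subset[OF negligible_convex_frontier[OF assms]] negligible_imp_sets by blast
  moreover have "interior S \<in> sets lebesgue" by simp
  moreover have "S = interior S \<union> (S \<inter> frontier S)"
    using interior_subset closure_subset by (auto simp: frontier_def)
  ultimately show ?thesis by (metis sets.Un)
qed

text \<open>A point outside the slab but below the height of \<open>p\<close> lies on a segment from
  \<open>p\<close> or \<open>- p\<close>, whichever is on its side, to a point on the boundary of
  the slab.\<close>

lemma strip_subset_convex_hull:
  fixes p e :: "'a::euclidean_space"
  assumes a: "0 \<le> a" "a < p \<bullet> e" and sym: "- p \<in> K" "p \<in> K"
  shows "{x. \<bar>x \<bullet> e\<bar> < p \<bullet> e} \<subseteq> convex hull (K \<union> {x. \<bar>x \<bullet> e\<bar> \<le> a})" (is "_ \<subseteq> ?H")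
proof
  fix x assume x: "x \<in> {x. \<bar>x \<bullet> e\<bar> < p \<bullet> e}"
  show "x \<in> ?H"
  proof (cases "\<bar>x \<bullet> e\<bar> \<le> a")
    case True
    then show ?thesis by (intro hull_inc) simp
  next
    case False
    have *: "x \<in> ?H" if q: "q \<in> K" "\<bar>q \<bullet> e\<bar> = p \<bullet> e" "x \<bullet> e * sgn (q \<bullet> e) = \<bar>x \<bullet> e\<bar>" for q
    proof -
      \<comment> \<open>Solves \<open>\<bar>x \<bullet> e\<bar> = m * (p \<bullet> e) + (1 - m) *
        a\<close>, which puts \<open>y\<close> at height \<open>a\<close> or \<open>- a\<close>.
        That \<open>x\<close> is strictly below the height of \<open>p\<close> gives
        \<open>m < 1\<close>.\<close>
      define m where "m = (\<bar>x \<bullet> e\<bar> - a) / (p \<bullet> e - a)"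
      have m: "0 \<le> m" "m < 1" using False x a by (auto simp: m_def field_simps)
      define y where "y = (1 / (1 - m)) *\<^sub>R (x - m *\<^sub>R q)"
      have xy: "x = m *\<^sub>R q + (1 - m) *\<^sub>R y" using m by (simp add: y_def)
      have mp: "m * (p \<bullet> e - a) = \<bar>x \<bullet> e\<bar> - a" using a by (simp add: m_def)
      have "\<bar>y \<bullet> e\<bar> \<le> a"
      proof -
        have qe: "q \<bullet> e = sgn (q \<bullet> e) * (p \<bullet> e)" "x \<bullet> e = sgn (q \<bullet> e) * \<bar>x \<bullet> e\<bar>" "\<bar>sgn (q \<bullet> e)\<bar> = 1"
          using q a x by (auto simp: sgn_if abs_if split: if_splits)
        have "(1 - m) * (y \<bullet> e) = x \<bullet> e - m * (q \<bullet> e)" using m by (simp add: y_def inner_simps)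
        also have "\<dots> = sgn (q \<bullet> e) * (\<bar>x \<bullet> e\<bar> - m * (p \<bullet> e))"
          by (subst qe(2), subst (2) qe(1)) (simp add: algebra_simps)
        also have "\<bar>x \<bullet> e\<bar> - m * (p \<bullet> e) = (1 - m) * a" using mp by (simp add: algebra_simps)
        finally have "(1 - m) * (y \<bullet> e) = (1 - m) * (sgn (q \<bullet> e) * a)" by simp
        then have "y \<bullet> e = sgn (q \<bullet> e) * a" using m by simp
        then show ?thesis using qe(3) a by (simp add: abs_mult)
      qed
      then have "q \<in> ?H" "y \<in> ?H" using q by (auto intro: hull_inc)
      then show ?thesis
        using convexD[OF convex_convex_hull, of q _ y m "1 - m"] m xy by simp
    qed
    show ?thesis
      using *[OF sym(2)] *[OF sym(1)] a by (cases "x \<bullet> e \<ge> 0") auto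
  qed
qed

theorem theorem1p2:
  fixes K :: "'a::euclidean_space set" and u :: 'a
  assumes "convex_body K"
    and "\<And>x. x \<in> K \<Longrightarrow> - x \<in> K"
  defines "T \<equiv> {x. \<bar>x \<bullet> u\<bar> \<le> 1}"
  shows "gamma (convex hull (K \<union> T)) * gamma (K \<inter> T) \<ge> gamma K * gamma T"
proof -
  interpret prob_space "gaussian_measure :: 'a measure" by (rule prob_space_gaussian_measure)
  have K: "compact K" "convex K" and sym: "\<And>x. x \<in> K \<Longrightarrow> - x \<in> K"
    using assms by (auto simp: convex_body_def)
  have [measurable]: "K \<in> sets borel" using K(1) by (simp add: borel_compact)
  have "T = {x. u \<bullet> x \<le> 1} \<inter> {x. u \<bullet> x \<ge> - 1}" by (auto simp: T_def inner_commute)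
  then have "convex T" by (simp add: convex_Int convex_halfspace_le convex_halfspace_ge)
  show ?thesis
  proof (cases "K \<subseteq> T")
    case True
    then have "convex hull (K \<union> T) = T" "K \<inter> T = K"
      using \<open>convex T\<close> by (auto simp: sup.absorb2 hull_same)
    then show ?thesis by simp
  next
    case False
    \<comment> \<open>For \<open>u = 0\<close> the slab would be the whole space and contain
      \<open>K\<close>.\<close>
    then have u: "u \<noteq> 0" by (auto simp: T_def)
    define e where "e = u /\<^sub>R norm u"
    define a where "a = 1 / norm u"
    have e: "norm e = 1" and a: "a > 0" using u by (auto simp: e_def a_def)
    have T: "T = {x. \<bar>x \<bullet> e\<bar> \<le> a}" using u by (auto simp: T_def e_def a_def field_simps abs_mult)
    have "K \<noteq> {}" using False by auto
    have "continuous_on K (\<lambda>x. x \<bullet> e)" by (intro continuous_intros)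
    from continuous_attains_sup[OF K(1) \<open>K \<noteq> {}\<close> this]
    obtain p where p: "p \<in> K" "\<And>x. x \<in> K \<Longrightarrow> x \<bullet> e \<le> p \<bullet> e" by auto
    define b where "b = p \<bullet> e"
    have Kb: "\<bar>x \<bullet> e\<bar> \<le> b" if "x \<in> K" for x
      using p(2)[OF that] p(2)[OF sym[OF that]] by (simp add: b_def abs_le_iff)
    have ab: "a < b" using False Kb by (force simp: T)
    define w where "w t = ennreal (std_normal_density t)" for t
    have [measurable]: "w \<in> borel_measurable borel" unfolding w_def by measurable
    \<comment> \<open>With the whole space as body, the slice formula thus computes the measure of
      strips.\<close>
    have univ: "slice_measure e UNIV t = 1" for t
      using emeasure_space_1 by (simp add: slice_measure_def emeasure_gaussian_measure)
    have em_strip: "emeasure gaussian_measure {x. x \<bullet> e \<in> J} = (\<integral>\<^sup>+t. w t * indicator J t \<partial>lborel)"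
      if "J \<in> sets borel" for J
      using gaussian_slices[OF e _ that, of UNIV] by (simp add: univ w_def)
    have em_K: "emeasure gaussian_measure {x \<in> K. x \<bullet> e \<in> J}
        = (\<integral>\<^sup>+t. w t * indicator J t * slice_measure e K t \<partial>lborel)" if "J \<in> sets borel" for J
      using gaussian_slices[OF e _ that, of K] by (simp add: w_def)
    have sets: "K = {x \<in> K. x \<bullet> e \<in> {-b..b}}" "T = {x. x \<bullet> e \<in> {-a..a}}"
      "K \<inter> T = {x \<in> K. x \<bullet> e \<in> {-a..a}}"
      using Kb by (force simp: T abs_le_iff)+
    have "emeasure gaussian_measure K * emeasure gaussian_measure T
      \<le> (\<integral>\<^sup>+t. w t * indicator {-b..b} t \<partial>lborel) * emeasure gaussian_measure (K \<inter> T)"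
    proof (subst sets(1), subst sets(2), subst sets(3), unfold em_K[OF borel_closed[OF closed_atLeastAtMost]] em_strip[OF borel_closed[OF closed_atLeastAtMost]])
      show "(\<integral>\<^sup>+t. w t * indicator {-b..b} t * slice_measure e K t \<partial>lborel) * (\<integral>\<^sup>+t. w t * indicator {-a..a} t \<partial>lborel)
        \<le> (\<integral>\<^sup>+t. w t * indicator {-b..b} t \<partial>lborel) * (\<integral>\<^sup>+t. w t * indicator {-a..a} t * slice_measure e K t \<partial>lborel)"
        using a ab slice_measure_antimono[OF _ K(2) sym]
        by (intro nn_integral_average_antimono) auto
    qed
    \<comment> \<open>The endpoints are null; only the open strip is known to lie in the
      hull.\<close>
    also have "(\<integral>\<^sup>+t. w t * indicator {-b..b} t \<partial>lborel) = (\<integral>\<^sup>+t. w t * indicator {-b<..<b} t \<partial>lborel)"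
      using AE_lborel_singleton[of "-b"] AE_lborel_singleton[of b]
      by (intro nn_integral_cong_AE) (auto simp: indicator_def)
    also have "\<dots> = emeasure gaussian_measure {x. x \<bullet> e \<in> {-b<..<b}}"
      by (rule em_strip[symmetric]) simp
    also have "\<dots> \<le> emeasure gaussian_measure (convex hull (K \<union> T))"
    proof (rule emeasure_mono)
      show "{x. x \<bullet> e \<in> {-b<..<b}} \<subseteq> convex hull (K \<union> T)"
        using strip_subset_convex_hull[of a p e K] a ab p(1) sym[OF p(1)]
        by (auto simp: T b_def abs_less_iff subset_iff)
      show "convex hull (K \<union> T) \<in> sets gaussian_measure"
        by (simp add: convex_sets_lebesgue)
    qed
    finally have "emeasure gaussian_measure K * emeasure gaussian_measure T
      \<le> emeasure gaussian_measure (convex hull (K \<union> T)) * emeasure gaussian_measure (K \<inter> T)"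
      by (simp add: mult_right_mono)
    then show ?thesis
      by (simp add: emeasure_eq_measure flip: ennreal_mult)
  qed
qed

end
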